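(* Let $s$ be a sequence indexed by the positive integers such that $s(i+2^{31}) = s(i)$ for every $i \ge 1$, and $s(i) \neq s(j)$ for all $1 \le i, j \le 2^{31}$ with $i \neq j$. Let $n \ge 1$ be an integer and let $A$ be the $n \times n$ matrix of size $n$ generated by the Linpack Benchmark 1.0 matrix generator, i.e. $A(i,j) = s((j-1)n + i)$ for $1 \le i,j \le n$. Write $n = 2^k \cdot q$ with $k \ge 0$ an integer and $q$ odd. Then the following are equivalent: (1) $n \in \mathcal{S}$; (2) the matrix $A$ has at least two identical columns; (3) $n > 2^{31-k}$.
   Context: A Linpack Benchmark 1.0 matrix generator is a rule which, for each size $n$, fills an $n\times n$ matrix column by column with consecutive terms of a sequence $s$: $A(i,j) = s((j-1)n+i)$ for $1 \le i,j \le n$, where $s$ is periodic with period $2^{31}$ ($s(i+2^{31})=s(i)$ for all $i$) and takes pairwise distinct values on the indices $1,\dots,2^{31}$. The set $\mathcal{S}$ is by definition the set of all positive integers $n$ such that the $n \times n$ matrix produced by this generator has at least two identical columns, i.e. there are column indices $j \neq j'$ in $\{1,\dots,n\}$ with $A(i,j)=A(i,j')$ for all $1 \le i \le n$. The quantity $2^{31-k}$ is understood as a real (rational) number, so it is less than $1$ when $k > 31$. *)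

theory Defs
  imports Complex_Main "Jordan_Normal_Form.Matrix"
begin

(* Library matrices have rows and columns indexed from 0, whereas the sequence s is
   indexed from 1 (s 0 is never used): the library entry (i, j) is the mathematical
   entry A(i + 1, j + 1) = s(j * n + (i + 1)). *)
definition linpack_matrix :: "(nat \<Rightarrow> 'a) \<Rightarrow> nat \<Rightarrow> 'a mat" where
  "linpack_matrix s n = mat n n (\<lambda>(i, j). s (j * n + (i + 1)))"

definition has_identical_columns :: "'a mat \<Rightarrow> bool" where
  "has_identical_columns A \<longleftrightarrow>
     (\<exists>j j'. j < dim_col A \<and> j' < dim_col A \<and> j \<noteq> j' \<and> col A j = col A j')"

definition linpack_sizes :: "(nat \<Rightarrow> 'a) \<Rightarrow> nat set" where
  "linpack_sizes s = {n. n \<ge> 1 \<and> has_identical_columns (linpack_matrix s n)}"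

end

theory Submission
  imports Defs "HOL-Number_Theory.Cong"
begin

text \<open>Within one period the sequence is injective, so two of its terms agree iff their indices are
  congruent modulo the period \<open>P\<close>. Columns \<open>j < j'\<close> therefore coincide iff \<open>P\<close> divides
  \<open>(j' - j) n\<close>, i.e. iff \<open>P / gcd(P, n)\<close> divides \<open>j' - j\<close>; such a pair of columns exists
  iff \<open>P / gcd(P, n) < n\<close>.\<close>

lemma periodic_distinct_eq_iff_cong:
  fixes s :: "nat \<Rightarrow> 'a" and P :: nat
  assumes "P > 0"
    and periodic: "\<And>i. i \<ge> 1 \<Longrightarrow> s (i + P) = s i"
    and distinct_terms:
      "\<And>i j. \<lbrakk>1 \<le> i; i \<le> P; 1 \<le> j; j \<le> P; i \<noteq> j\<rbrakk> \<Longrightarrow> s i \<noteq> s j"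
    and "a \<ge> 1" "b \<ge> 1"
  shows "s a = s b \<longleftrightarrow> [a = b] (mod P)"
proof -
  have add_mult: "s (c + m * P) = s c" if "c \<ge> 1" for c m
  proof (induction m)
    case (Suc m)
    have "s (c + Suc m * P) = s ((c + m * P) + P)"
      by (simp add: algebra_simps)
    also have "\<dots> = s c"
      using periodic[of "c + m * P"] that Suc by simp
    finally show ?case .
  qed simp
  \<comment> \<open>The representative of \<open>c\<close> in the range from 1 to \<open>P\<close>.
    Indices start at 1, so the residue is taken of \<open>c - 1\<close> and shifted back; a multiple
    of \<open>P\<close> is sent to \<open>P\<close> rather than to 0.\<close>
  define rep where "rep c = (c - 1) mod P + 1" for c
  have rep: "s c = s (rep c)" "1 \<le> rep c" "rep c \<le> P" if "c \<ge> 1" for c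
  proof -
    have "c = rep c + ((c - 1) div P) * P"
      using that div_mult_mod_eq[of "c - 1" P] unfolding rep_def by linarith
    then show "s c = s (rep c)"
      using add_mult[of "rep c" "(c - 1) div P"] by (simp add: rep_def)
    show "1 \<le> rep c" "rep c \<le> P"
      using \<open>P > 0\<close> by (simp_all add: rep_def Suc_leI)
  qed
  have "s a = s b \<longleftrightarrow> rep a = rep b"
    using rep[OF \<open>a \<ge> 1\<close>] rep[OF \<open>b \<ge> 1\<close>] distinct_terms by metis
  also have "\<dots> \<longleftrightarrow> [a - 1 = b - 1] (mod P)"
    by (simp add: rep_def cong_def)
  also have "\<dots> \<longleftrightarrow> [a - 1 + 1 = b - 1 + 1] (mod P)"
    by (simp only: cong_add_rcancel_nat)
  finally show ?thesis
    using \<open>a \<ge> 1\<close> \<open>b \<ge> 1\<close> by simp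
qed

lemma dvd_mult_iff_div_gcd_dvd:
  fixes P n d :: nat
  assumes "P > 0"
  shows "P dvd d * n \<longleftrightarrow> P div gcd P n dvd d"
proof -
  define g where "g = gcd P n"
  have "g > 0" using assms by (simp add: g_def)
  have P: "P = P div g * g" and n: "n = n div g * g"
    by (simp_all add: g_def)
  have "coprime (P div g) (n div g)"
    using assms by (simp add: g_def div_gcd_coprime)
  have "P dvd d * n \<longleftrightarrow> P div g * g dvd (d * (n div g)) * g"
    using P n by (metis mult.assoc)
  also have "\<dots> \<longleftrightarrow> P div g dvd d * (n div g)"
    using \<open>g > 0\<close> by simp
  also have "\<dots> \<longleftrightarrow> P div g dvd d"
    using \<open>coprime (P div g) (n div g)\<close> by (simp add: coprime_dvd_mult_left_iff)
  finally show ?thesis by (simp add: g_def)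
qed

lemma has_identical_columns_linpack_iff:
  fixes s :: "nat \<Rightarrow> 'a" and P n :: nat
  assumes "P > 0"
    and periodic: "\<And>i. i \<ge> 1 \<Longrightarrow> s (i + P) = s i"
    and distinct_terms:
      "\<And>i j. \<lbrakk>1 \<le> i; i \<le> P; 1 \<le> j; j \<le> P; i \<noteq> j\<rbrakk> \<Longrightarrow> s i \<noteq> s j"
    and "n \<ge> 1"
  shows "has_identical_columns (linpack_matrix s n) \<longleftrightarrow> P div gcd P n < n"
proof -
  let ?A = "linpack_matrix s n"
  note s_eq_iff = periodic_distinct_eq_iff_cong[where s = s and P = P, OF \<open>P > 0\<close> periodic distinct_terms]
  have "0 < n"
    using \<open>n \<ge> 1\<close> by simp
  have col_eq_iff: "col ?A j = col ?A j' \<longleftrightarrow> [j * n = j' * n] (mod P)"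
    if "j < n" "j' < n" for j j'
  proof -
    have "col ?A j = col ?A j' \<longleftrightarrow>
        (\<forall>i<n. s (j * n + (i + 1)) = s (j' * n + (i + 1)))"
      using that by (auto simp: linpack_matrix_def vec_eq_iff)
    also have "\<dots> \<longleftrightarrow> (\<forall>i<n. [j * n + (i + 1) = j' * n + (i + 1)] (mod P))"
      by (simp add: s_eq_iff del: add_Suc_right)
    \<comment> \<open>The row offset \<open>i + 1\<close> cancels, so all rows impose the same
      condition; \<open>0 < n\<close> supplies a row, without which the quantifier would be
      vacuous.\<close>
    also have "\<dots> \<longleftrightarrow> [j * n = j' * n] (mod P)"
      unfolding cong_add_rcancel_nat using \<open>0 < n\<close> by blast
    finally show ?thesis .
  qed
  have col_eq_diff: "col ?A j = col ?A j' \<longleftrightarrow> P div gcd P n dvd j' - j"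
    if "j < j'" "j' < n" for j j'
  proof -
    have "col ?A j = col ?A j' \<longleftrightarrow> [j' * n = j * n] (mod P)"
      using that by (subst col_eq_iff) (auto intro: cong_sym)
    \<comment> \<open>The larger product stands on the left, so the truncated subtraction on
      \<open>nat\<close> is a true difference.\<close>
    also have "\<dots> \<longleftrightarrow> P dvd (j' - j) * n"
      using that by (simp only: cong_altdef_nat mult_le_mono1 less_imp_le diff_mult_distrib)
    finally show ?thesis
      by (simp add: dvd_mult_iff_div_gcd_dvd[OF \<open>P > 0\<close>])
  qed
  have "has_identical_columns ?A \<longleftrightarrow> (\<exists>j j'. j < j' \<and> j' < n \<and> col ?A j = col ?A j')"
  proof -
    have "dim_col ?A = n"
      by (simp add: linpack_matrix_def)
    then show ?thesis
      unfolding has_identical_columns_def nat_neq_iff by (metis less_trans)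
  qed
  also have "\<dots> \<longleftrightarrow> P div gcd P n < n"
  proof
    assume "\<exists>j j'. j < j' \<and> j' < n \<and> col ?A j = col ?A j'"
    then obtain j j' where "j < j'" "j' < n" "P div gcd P n dvd j' - j"
      using col_eq_diff by blast
    then show "P div gcd P n < n"
      \<comment> \<open>A divisor of the positive number \<open>j' - j\<close> is at most
        \<open>j' - j\<close>, hence below \<open>n\<close>.\<close>
      using dvd_imp_le[of "P div gcd P n" "j' - j"] by linarith
  next
    assume "P div gcd P n < n"
    moreover have "0 < P div gcd P n"
      using \<open>P > 0\<close> by (simp add: div_greater_zero_iff gcd_le1_nat)
    ultimately show "\<exists>j j'. j < j' \<and> j' < n \<and> col ?A j = col ?A j'"
      \<comment> \<open>Column 0 and the column at the least admissible distance from it serve as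
        witnesses; they differ because that distance is positive.\<close>
      using col_eq_diff[of 0 "P div gcd P n"] by auto
  qed
  finally show ?thesis .
qed

text \<open>The odd factor is coprime to \<open>2 ^ m\<close>, which leaves two powers of 2, one
  dividing the other.\<close>

lemma gcd_two_power_mult_odd:
  fixes q :: nat
  assumes "odd q"
  shows "gcd (2 ^ m) (2 ^ k * q) = 2 ^ min m k"
proof -
  have "coprime (2 ^ m) q" using assms by simp
  then have "gcd (2 ^ m) (2 ^ k * q) = gcd (2 ^ m) (2 ^ k)"
    by (simp add: gcd_mult_right_right_cancel)
  also have "\<dots> = 2 ^ min m k"
    by (cases "m \<le> k") (simp_all add: gcd_nat.absorb1 gcd_nat.absorb2 le_imp_power_dvd)
  finally show ?thesis .
qed

theorem mainTheorem1:
  fixes s :: "nat \<Rightarrow> 'a" and n k q :: nat and A :: "'a mat"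
  assumes periodic: "\<And>i. i \<ge> 1 \<Longrightarrow> s (i + 2 ^ 31) = s i"
    and distinct_terms:
      "\<And>i j. \<lbrakk>1 \<le> i; i \<le> 2 ^ 31; 1 \<le> j; j \<le> 2 ^ 31; i \<noteq> j\<rbrakk> \<Longrightarrow> s i \<noteq> s j"
    and n_pos: "n \<ge> 1"
    and A_eq: "A = linpack_matrix s n"
    and n_eq: "n = 2 ^ k * q"
    and q_odd: "odd q"
  shows "(n \<in> linpack_sizes s \<longleftrightarrow> has_identical_columns A) \<and>
         (has_identical_columns A \<longleftrightarrow> real n > 2 powi (31 - int k))"
proof
  show "n \<in> linpack_sizes s \<longleftrightarrow> has_identical_columns A"
    using n_pos by (simp add: linpack_sizes_def A_eq)
  have "has_identical_columns A \<longleftrightarrow> 2 ^ 31 div gcd (2 ^ 31) n < n"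
    unfolding A_eq
    by (rule has_identical_columns_linpack_iff
        [where s = s and P = "2 ^ 31", OF _ periodic distinct_terms n_pos]) simp_all
  also have "gcd (2 ^ 31) n = 2 ^ min 31 k"
    unfolding n_eq by (rule gcd_two_power_mult_odd[OF q_odd])
  \<comment> \<open>A natural quotient is compared with a real power whose exponent may be negative.
    For \<open>k \<le> 31\<close> the two bounds have the same value.\<close>
  also have "(2 ^ 31 div 2 ^ min 31 k < n) \<longleftrightarrow> real n > 2 powi (31 - int k)"
  proof (cases "k \<le> 31")
    case True
    then have "(2::nat) ^ 31 div 2 ^ min 31 k = 2 ^ (31 - k)"
      by (simp add: min_absorb2 power_diff del: power_numeral)
    moreover have "(2::real) powi (31 - int k) = real (2 ^ (31 - k))"
      using True by (simp add: power_int_def nat_diff_distrib)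
    ultimately show ?thesis
      by (simp only: of_nat_less_iff)
  next
    \<comment> \<open>Here the quotient is 1 and the real power is at most 1, so the bounds may
      differ, but both inequalities hold because \<open>2 ^ k\<close> divides \<open>n\<close> and
      forces \<open>2 \<le> n\<close>.\<close>
    case False
    have "(2::real) powi (31 - int k) \<le> 2 powi 0"
      using False by (intro power_int_increasing) auto
    have "2 \<le> (2::nat) ^ k"
      using False self_le_power[of 2 k] by simp
    moreover have "q \<ge> 1"
      using q_odd by (cases q) auto
    ultimately have "2 \<le> n"
      using mult_le_mono[of 2 "2 ^ k" 1 q] by (simp add: n_eq)
    then show ?thesis
      using False \<open>(2::real) powi (31 - int k) \<le> 2 powi 0\<close> by simp
  qed
  finally show "has_identical_columns A \<longleftrightarrow> real n > 2 powi (31 - int k)" .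
qed

end
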